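(* Let $X$ be a complex Banach space, $\omega>0$, $c\in\mathbb{C}\setminus\{0\}$, and let $A$ be the infinitesimal generator of a strongly continuous semigroup $\{S(t)\}_{t\ge0}$ of bounded linear operators on $X$. Let $Q\ge1$ and $\gamma\in\mathbb{R}$ be constants with $\|S(t)\|\le Qe^{\gamma t}$ for all $t\ge0$. Suppose $c\notin\sigma(S(\omega))$. Let $g\in C(\mathbb{R}_+\times X,X)$ satisfy (i) $g(t+\omega,cy)=cg(t,y)$ for all $t\in\mathbb{R}_+$ and $y\in X$; (ii) there is a constant $L>0$ such that $\|g(t,y_1)-g(t,y_2)\|\le L\|y_1-y_2\|$ for all $t\in\mathbb{R}_+$ and $y_1,y_2\in X$. Define $$U=\begin{cases}\dfrac{Q(e^{\gamma\omega}-1)}{\gamma}\,\|(cI-S(\omega))^{-1}\|\max\{|c|,1\}&\text{if }\gamma\neq0,\\[2mm] Q\omega\,\|(cI-S(\omega))^{-1}\|\max\{|c|,1\}&\text{if }\gamma=0.\end{cases}$$ If $LU<1$, then the equation $\dot y=Ay+g(t,y)$ has a unique $(\omega,c)$-periodic mild solution $y\in C(\mathbb{R}_+,X)$, and it satisfies $$\|y\|_0\le\frac{U\|g(\cdot,0)\|_0}{1-LU}.$$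
   Context: $\mathbb{R}_+=[0,\infty)$. A function $y:\mathbb{R}_+\to X$ is $(\omega,c)$-periodic if $y(t+\omega)=cy(t)$ for all $t\in\mathbb{R}_+$. A mild solution of $\dot y=Ay+g(t,y)$ is a function $y\in C(\mathbb{R}_+,X)$ such that for some $y_0\in X$ $$y(t)=S(t)y_0+\int_0^tS(t-s)g(s,y(s))\,ds\quad\text{for all }t\in\mathbb{R}_+.$$ For a continuous $X$-valued function $h$ defined on a set containing $[0,\omega]$, $\|h\|_0=\max_{t\in[0,\omega]}\|h(t)\|$. $I$ is the identity on $X$ and $\sigma(\cdot)$ denotes the spectrum. *)

theory Defs
  imports "HOL-Analysis.Analysis"
begin

text \<open>The distribution has no class of complex normed spaces. The real structure is the
  restriction of the complex one, so that limits, integrals and operator norms of the real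
  theory are those of the complex space.\<close>

class complex_normed_vector = real_normed_vector +
  fixes scaleC :: "complex \<Rightarrow> 'a \<Rightarrow> 'a" (infixr "*\<^sub>C" 75)
  assumes scaleC_add_right: "a *\<^sub>C (x + y) = a *\<^sub>C x + a *\<^sub>C y"
    and scaleC_add_left: "(a + b) *\<^sub>C x = a *\<^sub>C x + b *\<^sub>C x"
    and scaleC_scaleC: "a *\<^sub>C b *\<^sub>C x = (a * b) *\<^sub>C x"
    and scaleC_one: "1 *\<^sub>C x = x"
    and scaleR_scaleC: "r *\<^sub>R x = complex_of_real r *\<^sub>C x"
    and norm_scaleC: "norm (a *\<^sub>C x) = cmod a * norm x"

class complex_banach = complex_normed_vector + banach

instantiation complex :: complex_banach
begin

definition scaleC_complex :: "complex \<Rightarrow> complex \<Rightarrow> complex"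
  where "scaleC_complex a x = a * x"

instance
  by standard (auto simp: scaleC_complex_def algebra_simps scaleR_conv_of_real norm_mult)

end

definition bounded_clinear :: "('a::complex_normed_vector \<Rightarrow> 'b::complex_normed_vector) \<Rightarrow> bool"
  where "bounded_clinear f \<longleftrightarrow>
    bounded_linear f \<and> (\<forall>a x. f (a *\<^sub>C x) = a *\<^sub>C f x)"

definition resolvent_set :: "('a::complex_normed_vector \<Rightarrow> 'a) \<Rightarrow> complex set"
  where "resolvent_set T =
    {z. bij (\<lambda>x. z *\<^sub>C x - T x) \<and> bounded_clinear (inv (\<lambda>x. z *\<^sub>C x - T x))}"

definition spectrum :: "('a::complex_normed_vector \<Rightarrow> 'a) \<Rightarrow> complex set"
  where "spectrum T = - resolvent_set T"

text \<open>Families indexed by \<open>[0,\<infinity>)\<close> and functions on \<open>[0,\<infinity>)\<close> are total functions on the reals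
  whose values at negative arguments are never used.\<close>

definition C0_semigroup :: "(real \<Rightarrow> 'a::complex_banach \<Rightarrow> 'a) \<Rightarrow> bool"
  where "C0_semigroup S \<longleftrightarrow>
    (\<forall>t\<ge>0. bounded_clinear (S t)) \<and>
    S 0 = id \<and>
    (\<forall>s\<ge>0. \<forall>t\<ge>0. S (s + t) = S s \<circ> S t) \<and>
    (\<forall>x. ((\<lambda>t. S t x) \<longlongrightarrow> x) (at_right 0))"

text \<open>A (possibly unbounded) operator is given by its domain \<open>D\<close> and a map \<open>A\<close>, of which
  only the values on \<open>D\<close> matter.\<close>

definition infinitesimal_generator ::
    "(real \<Rightarrow> 'a::complex_banach \<Rightarrow> 'a) \<Rightarrow> 'a set \<Rightarrow> ('a \<Rightarrow> 'a) \<Rightarrow> bool"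
  where "infinitesimal_generator S D A \<longleftrightarrow>
    D = {x. \<exists>l. ((\<lambda>h. (S h x - x) /\<^sub>R h) \<longlongrightarrow> l) (at_right 0)} \<and>
    (\<forall>x\<in>D. ((\<lambda>h. (S h x - x) /\<^sub>R h) \<longlongrightarrow> A x) (at_right 0))"

definition omega_c_periodic :: "real \<Rightarrow> complex \<Rightarrow> (real \<Rightarrow> 'a::complex_banach) \<Rightarrow> bool"
  where "omega_c_periodic \<omega> c y \<longleftrightarrow> (\<forall>t\<ge>0. y (t + \<omega>) = c *\<^sub>C y t)"

text \<open>Mild solutions of \<open>y' = A y + g(t,y)\<close>, where \<open>A\<close> generates \<open>S\<close>; as usual, \<open>A\<close> enters
  only through its semigroup.\<close>

definition mild_solution ::
    "(real \<Rightarrow> 'a::complex_banach \<Rightarrow> 'a) \<Rightarrow> (real \<Rightarrow> 'a \<Rightarrow> 'a) \<Rightarrow> (real \<Rightarrow> 'a) \<Rightarrow> bool"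
  where "mild_solution S g y \<longleftrightarrow>
    continuous_on {0..} y \<and>
    (\<exists>y0. \<forall>t\<ge>0.
      (\<lambda>s. S (t - s) (g s (y s))) integrable_on {0..t} \<and>
      y t = S t y0 + integral {0..t} (\<lambda>s. S (t - s) (g s (y s))))"

text \<open>The supremum is a maximum for \<open>h\<close> continuous on \<open>[0,\<omega>]\<close>.\<close>

definition norm0 :: "real \<Rightarrow> (real \<Rightarrow> 'a::real_normed_vector) \<Rightarrow> real"
  where "norm0 \<omega> h = (SUP t\<in>{0..\<omega>}. norm (h t))"

end

theory Submission
  imports Defs
begin

text \<open>Write \<open>R = (cI - S(\<omega>))\<^sup>-\<^sup>1\<close>. A periodic mild solution with forcing \<open>f(s) = g(s,y(s))\<close> must
  start at \<open>R \<integral>\<^sub>0\<^sup>\<omega> S(\<omega>-s) f(s) ds\<close>, and since \<open>R\<close> commutes with the semigroup it equals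
  \<open>R (\<integral>\<^sub>t\<^sup>\<omega> S(t+\<omega>-s) f(s) ds + c \<integral>\<^sub>0\<^sup>t S(t-s) f(s) ds)\<close> on \<open>[0,\<omega>]\<close>. The semigroup times occurring in the
  two integrals fill \<open>[t,\<omega>]\<close> and \<open>[0,t]\<close>, so this is at most \<open>U\<close> times the sup norm of \<open>f\<close>.
  With the Lipschitz condition the map is a contraction with constant \<open>LU\<close> of
  \<open>C([0,\<omega>],X)\<close>; its fixed point extends periodically to the solution.\<close>

section \<open>Complex scalars, continuity and integration\<close>

lemma bounded_linear_scaleC: "bounded_linear (\<lambda>x::'a::complex_normed_vector. a *\<^sub>C x)"
proof
  show "\<exists>K. \<forall>x::'a. norm (a *\<^sub>C x) \<le> norm x * K"
    by (rule exI[of _ "cmod a"]) (simp add: norm_scaleC mult.commute)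
qed (auto simp: scaleC_add_right scaleR_scaleC scaleC_scaleC mult.commute)

lemma continuous_on_scaleC [continuous_intros]:
  "continuous_on A f \<Longrightarrow> continuous_on A (\<lambda>x. a *\<^sub>C f x)"
  for f :: "'b::topological_space \<Rightarrow> 'a::complex_normed_vector"
  by (rule bounded_linear.continuous_on[OF bounded_linear_scaleC])

lemma integral_scaleC:
  fixes f :: "real \<Rightarrow> 'a::complex_banach"
  assumes "f integrable_on A"
  shows "integral A (\<lambda>s. a *\<^sub>C f s) = a *\<^sub>C integral A f"
  using integral_linear[OF assms bounded_linear_scaleC[of a]] by (simp add: o_def)

section \<open>Functions on the half-line determined by one period\<close>

lemma nonneg_period_induct [consumes 2, case_names base step]:
  assumes "\<omega> > 0" and "t \<ge> (0::real)"
    and base: "\<And>t. 0 \<le> t \<Longrightarrow> t \<le> \<omega> \<Longrightarrow> P t"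
    and step: "\<And>t. 0 \<le> t \<Longrightarrow> P t \<Longrightarrow> P (t + \<omega>)"
  shows "P t"
proof -
  have *: "0 \<le> t \<Longrightarrow> t \<le> real n * \<omega> \<Longrightarrow> P t" for n t
  proof (induction n arbitrary: t)
    case 0
    then show ?case using base \<open>\<omega> > 0\<close> by simp
  next
    case (Suc n)
    show ?case
    proof (cases "t \<le> \<omega>")
      case True
      then show ?thesis using base Suc by simp
    next
      case False
      then have "P (t - \<omega>)" using Suc by (intro Suc.IH) (auto simp: algebra_simps)
      then show ?thesis using step[of "t - \<omega>"] False by simp
    qed
  qed
  obtain n where "t < real n * \<omega>"
    using reals_Archimedean3[OF \<open>\<omega> > 0\<close>] by blast
  then show ?thesis using *[of t n] \<open>t \<ge> 0\<close> by simp
qed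

text \<open>The extension multiplies translates of \<open>u\<close> by powers of \<open>c\<close>.
  The condition \<open>match\<close> makes consecutive pieces agree where they meet, so continuity
  follows by gluing finitely many closed intervals.\<close>

lemma omega_c_periodic_extension:
  fixes u :: "real \<Rightarrow> 'a::complex_banach"
  assumes "\<omega> > 0" and cont: "continuous_on {0..\<omega>} u" and match: "u \<omega> = c *\<^sub>C u 0"
  obtains y where "continuous_on {0..} y" and "omega_c_periodic \<omega> c y"
    and "\<And>t. 0 \<le> t \<Longrightarrow> t \<le> \<omega> \<Longrightarrow> y t = u t"
proof -
  define k where "k t = nat \<lfloor>t / \<omega>\<rfloor>" for t
  define y where "y t = c ^ k t *\<^sub>C u (t - real (k t) * \<omega>)" for t
  have per: "y (t + \<omega>) = c *\<^sub>C y t" if "t \<ge> 0" for t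
  proof -
    have "(t + \<omega>) / \<omega> = t / \<omega> + 1" using \<open>\<omega> > 0\<close> by (simp add: field_simps)
    moreover have "t / \<omega> \<ge> 0" using that \<open>\<omega> > 0\<close> by simp
    ultimately have "k (t + \<omega>) = Suc (k t)"
      unfolding k_def by (simp add: nat_add_distrib)
    then show ?thesis by (simp add: y_def algebra_simps scaleC_scaleC)
  qed
  have eq: "y t = u t" if "0 \<le> t" "t \<le> \<omega>" for t
  proof (cases "t = \<omega>")
    case True
    \<comment> \<open>The floor already jumps at the right endpoint, so \<open>y\<close> takes the
      value \<open>c *\<^sub>C u 0\<close> there; \<open>match\<close> identifies it with
      \<open>u \<omega>\<close>.\<close>
    then have "k t = 1" using \<open>\<omega> > 0\<close> by (simp add: k_def)
    then show ?thesis using True match by (simp add: y_def)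
  next
    case False
    then have "t / \<omega> < 1" "t / \<omega> \<ge> 0" using that \<open>\<omega> > 0\<close> by auto
    then have "\<lfloor>t / \<omega>\<rfloor> = 0" by linarith
    then have "k t = 0" unfolding k_def by simp
    then show ?thesis by (simp add: y_def scaleC_one)
  qed
  have *: "continuous_on {0..real n * \<omega>} y" for n
  proof (induction n)
    case 0
    then show ?case by simp
  next
    case (Suc n)
    have "continuous_on {\<omega>..real (Suc n) * \<omega>} (\<lambda>t. c *\<^sub>C y (t - \<omega>))"
      by (intro continuous_intros continuous_on_compose2[OF Suc.IH])
        (auto simp: algebra_simps)
    moreover have "c *\<^sub>C y (t - \<omega>) = y t" if "t \<in> {\<omega>..real (Suc n) * \<omega>}" for t
      using per[of "t - \<omega>"] that by simp
    ultimately have "continuous_on {\<omega>..real (Suc n) * \<omega>} y"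
      by (metis (no_types, lifting) continuous_on_cong)
    moreover have "continuous_on {0..\<omega>} y"
      using cont by (rule continuous_on_eq) (auto simp: eq)
    ultimately have "continuous_on ({0..\<omega>} \<union> {\<omega>..real (Suc n) * \<omega>}) y"
      by (intro continuous_on_closed_Un) auto
    moreover have "{0..\<omega>} \<union> {\<omega>..real (Suc n) * \<omega>} = {0..real (Suc n) * \<omega>}"
      using \<open>\<omega> > 0\<close> by (intro ivl_disj_un_two_touch) (auto simp: algebra_simps)
    ultimately show ?case by simp
  qed
  have "continuous (at t within {0..}) y" if "t \<in> {0..}" for t
  proof -
    obtain n where n: "t < real n * \<omega>" using reals_Archimedean3[OF \<open>\<omega> > 0\<close>] by blast
    then have "continuous (at t within {0..real n * \<omega>}) y"
      using *[of n] that by (simp add: continuous_on_eq_continuous_within)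
    \<comment> \<open>Since \<open>t\<close> lies strictly below the right end, truncating the
      half-line does not change its neighbourhoods.\<close>
    moreover have "at t within {0..real n * \<omega>} = at t within {0..}"
      using n by (intro at_within_nhd[of _ "{..<real n * \<omega>}"]) auto
    ultimately show ?thesis by simp
  qed
  then have "continuous_on {0..} y" by (simp add: continuous_on_eq_continuous_within)
  then show thesis using that per eq by (simp add: omega_c_periodic_def)
qed

section \<open>Joint continuity of the semigroup\<close>

locale bounded_C0_semigroup =
  fixes S :: "real \<Rightarrow> 'a::complex_banach \<Rightarrow> 'a" and Q \<gamma> :: real
  assumes C0: "C0_semigroup S"
    and onorm_le: "\<And>t. t \<ge> 0 \<Longrightarrow> onorm (S t) \<le> Q * exp (\<gamma> * t)"
begin

lemma S_bounded_linear: "t \<ge> 0 \<Longrightarrow> bounded_linear (S t)"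
  and S_scaleC: "t \<ge> 0 \<Longrightarrow> S t (a *\<^sub>C x) = a *\<^sub>C S t x"
  and S_0: "S 0 x = x"
  and S_add: "s \<ge> 0 \<Longrightarrow> t \<ge> 0 \<Longrightarrow> S (s + t) x = S s (S t x)"
  and S_tendsto: "((\<lambda>t. S t x) \<longlongrightarrow> x) (at_right 0)"
  using C0 by (auto simp: C0_semigroup_def bounded_clinear_def)

lemma S_diff: "t \<ge> 0 \<Longrightarrow> S t (x - y) = S t x - S t y"
  and S_plus: "t \<ge> 0 \<Longrightarrow> S t (x + y) = S t x + S t y"
  using S_bounded_linear[of t] by (simp_all add: linear_simps)

lemma Q_nonneg: "Q \<ge> 0"
  using onorm_le[of 0] onorm_pos_le[OF S_bounded_linear[of 0]] by simp

lemma norm_S_le: "t \<ge> 0 \<Longrightarrow> norm (S t x) \<le> Q * exp (\<gamma> * t) * norm x"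
  by (meson S_bounded_linear mult_right_mono norm_ge_zero onorm onorm_le order_trans)

text \<open>Factoring out the operator at the smaller of the two times leaves the increment over
  \<open>\<bar>t - s\<bar>\<close>. Approach from either side thus reduces to right continuity at 0,
  the factor being bounded uniformly.\<close>

lemma S_tendsto_within:
  assumes "s \<ge> 0"
  shows "((\<lambda>t. S t x) \<longlongrightarrow> S s x) (at s within {0..})"
proof -
  have bound: "norm (S t x - S s x) \<le> Q * exp (\<bar>\<gamma>\<bar> * s) * norm (S \<bar>t - s\<bar> x - x)"
    if "t \<ge> 0" for t
  proof -
    define m where "m = min t s"
    have m: "0 \<le> m" "m \<le> s" using that assms by (auto simp: m_def)
    have "norm (S t x - S s x) = norm (S m (S \<bar>t - s\<bar> x - x))"
    proof (cases "t \<le> s")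
      case True
      then show ?thesis using that S_add[of t "s - t" x]
        by (simp add: S_diff m_def norm_minus_commute)
    next
      case False
      then show ?thesis using assms S_add[of s "t - s" x] by (simp add: S_diff m_def)
    qed
    also have "\<dots> \<le> Q * exp (\<gamma> * m) * norm (S \<bar>t - s\<bar> x - x)"
      using m by (intro norm_S_le)
    also have "\<gamma> * m \<le> \<bar>\<gamma>\<bar> * s" using m by (intro mult_mono) auto
    then have "Q * exp (\<gamma> * m) * norm (S \<bar>t - s\<bar> x - x)
        \<le> Q * exp (\<bar>\<gamma>\<bar> * s) * norm (S \<bar>t - s\<bar> x - x)"
      by (intro mult_right_mono mult_left_mono Q_nonneg) auto
    finally show ?thesis .
  qed
  have "((\<lambda>t. \<bar>t - s\<bar>) \<longlongrightarrow> \<bar>s - s\<bar>) (at s within {0..})" by (intro tendsto_intros)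
  \<comment> \<open>The punctured filter at \<open>s\<close> excludes \<open>t = s\<close>, so the
    distance tends to 0 through positive values, as \<open>at_right 0\<close> demands.\<close>
  then have "filterlim (\<lambda>t. \<bar>t - s\<bar>) (at_right 0) (at s within {0..})"
    by (auto simp: filterlim_at eventually_at_filter)
  then have "((\<lambda>t. S \<bar>t - s\<bar> x) \<longlongrightarrow> x) (at s within {0..})"
    using filterlim_compose[OF S_tendsto] by blast
  then have "((\<lambda>t. Q * exp (\<bar>\<gamma>\<bar> * s) * norm (S \<bar>t - s\<bar> x - x))
      \<longlongrightarrow> Q * exp (\<bar>\<gamma>\<bar> * s) * norm (x - x)) (at s within {0..})"
    by (intro tendsto_intros)
  then have lim: "((\<lambda>t. Q * exp (\<bar>\<gamma>\<bar> * s) * norm (S \<bar>t - s\<bar> x - x)) \<longlongrightarrow> 0) (at s within {0..})"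
    by simp
  have "((\<lambda>t. S t x - S s x) \<longlongrightarrow> 0) (at s within {0..})"
    by (rule Lim_null_comparison[OF _ lim]) (auto simp: eventually_at_filter bound)
  then show ?thesis by (simp add: LIM_zero_iff)
qed

text \<open>Strong continuity upgrades to joint continuity because the operator norms are locally
  bounded: \<open>S t (x - x0)\<close> is controlled by the exponential bound, and
  \<open>S t x0 - S t0 x0\<close> by continuity of a single orbit. This makes every integrand below
  continuous.\<close>

lemma S_jointly_continuous: "continuous_on ({0..} \<times> UNIV) (\<lambda>(t, x). S t x)"
proof -
  have "((\<lambda>(t, x). S t x) \<longlongrightarrow> S t0 x0) (at (t0, x0) within {0..} \<times> UNIV)"
    if t0: "t0 \<ge> 0" for t0 x0
  proof -
    let ?F = "at (t0, x0) within {0..} \<times> UNIV"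
    have fst: "((\<lambda>p. fst p) \<longlongrightarrow> t0) ?F" and snd: "((\<lambda>p. snd p) \<longlongrightarrow> x0) ?F"
      by (auto intro!: tendsto_eq_intros)
    have dom: "eventually (\<lambda>p. fst p \<ge> 0) ?F"
      unfolding eventually_at_filter by (rule always_eventually) auto
    have "continuous_on {0..} (\<lambda>t. S t x0)"
      by (auto simp: continuous_on_def S_tendsto_within)
    then have "((\<lambda>p. S (fst p) x0) \<longlongrightarrow> S t0 x0) ?F"
      by (rule continuous_on_tendsto_compose[OF _ fst]) (use t0 dom in auto)
    then have "((\<lambda>p. Q * exp (\<gamma> * fst p) * norm (snd p - x0) + norm (S (fst p) x0 - S t0 x0))
        \<longlongrightarrow> Q * exp (\<gamma> * t0) * norm (x0 - x0) + norm (S t0 x0 - S t0 x0)) ?F"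
      by (intro tendsto_intros fst snd)
    then have lim: "((\<lambda>p. Q * exp (\<gamma> * fst p) * norm (snd p - x0)
        + norm (S (fst p) x0 - S t0 x0)) \<longlongrightarrow> 0) ?F"
      by simp
    have "norm (S t x - S t0 x0) \<le> Q * exp (\<gamma> * t) * norm (x - x0) + norm (S t x0 - S t0 x0)"
      if "t \<ge> 0" for t x
    proof -
      have "S t x - S t0 x0 = S t (x - x0) + (S t x0 - S t0 x0)" using that by (simp add: S_diff)
      then show ?thesis using norm_S_le[OF that] by (metis add_mono_thms_linordered_semiring(3) norm_triangle_le)
    qed
    then have "((\<lambda>p. S (fst p) (snd p) - S t0 x0) \<longlongrightarrow> 0) ?F"
      by (intro Lim_null_comparison[OF _ lim] eventually_mono[OF dom]) auto
    then show ?thesis by (simp add: LIM_zero_iff case_prod_beta')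
  qed
  then show ?thesis by (auto simp: continuous_on_def)
qed

lemma continuous_on_S [continuous_intros]:
  assumes "continuous_on A a" "continuous_on A f" "\<And>z. z \<in> A \<Longrightarrow> a z \<ge> 0"
  shows "continuous_on A (\<lambda>z. S (a z) (f z))"
  using continuous_on_compose2[OF S_jointly_continuous continuous_on_Pair[OF assms(1,2)]] assms(3)
  by auto

section \<open>Integrals against the semigroup and the convolution\<close>

lemma S_shift_integrable:
  assumes "continuous_on {a..b} f" "b \<le> r"
  shows "(\<lambda>s. S (r - s) (f s)) integrable_on {a..b}"
  using assms by (intro integrable_continuous_real continuous_intros) auto

text \<open>A bounded operator passes under the integral, and the semigroup law adds the times. The
  condition \<open>b \<le> r\<close> keeps all times nonnegative.\<close>

lemma S_integral_shift:
  assumes "continuous_on {a..b} f" "b \<le> r" "t \<ge> 0"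
  shows "S t (integral {a..b} (\<lambda>s. S (r - s) (f s))) = integral {a..b} (\<lambda>s. S (t + r - s) (f s))"
proof -
  have "S t (integral {a..b} (\<lambda>s. S (r - s) (f s)))
      = integral {a..b} (S t \<circ> (\<lambda>s. S (r - s) (f s)))"
    using integral_linear[OF S_shift_integrable[OF assms(1,2)] S_bounded_linear[OF assms(3)]] by simp
  also have "\<dots> = integral {a..b} (\<lambda>s. S (t + r - s) (f s))"
    using assms by (intro integral_cong) (auto simp: S_add[symmetric] add_diff_eq)
  finally show ?thesis .
qed

definition conv :: "(real \<Rightarrow> 'a) \<Rightarrow> real \<Rightarrow> 'a"
  where "conv f t = integral {0..t} (\<lambda>s. S (t - s) (f s))"

text \<open>Both the domain of integration and the integrand vary with \<open>t\<close>.
  Substituting \<open>s = t * r\<close> fixes the domain to the unit interval, leaving an integral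
  with a continuous parameter. The substitution degenerates at \<open>t = 0\<close>, where both
  sides vanish.\<close>

lemma continuous_on_conv:
  assumes f: "continuous_on {0..b} f"
  shows "continuous_on {0..b} (conv f)"
proof -
  have eq: "conv f t = t *\<^sub>R integral (cbox 0 1) (\<lambda>r. S (t - t * r) (f (t * r)))"
    if t: "t \<in> {0..b}" for t
  proof (cases "t = 0")
    case True
    then show ?thesis by (simp add: conv_def)
  next
    case False
    then have "t > 0" using t by simp
    then have "(\<lambda>x. x / t) ` {0..t} = {0..1}"
      using image_divide_atLeastAtMost[of t 0 t] by simp
    then show ?thesis
      using integral_stretch_real[of t 0 t "\<lambda>s. S (t - s) (f s)"] \<open>t > 0\<close>
      by (simp add: conv_def)
  qed
  have dom: "0 \<le> t * r" "t * r \<le> t" if "t \<in> {0..b}" "r \<in> {0..1}" for t r :: real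
    using that by (auto simp: mult_left_le)
  have "continuous_on ({0..b} \<times> cbox 0 1) (\<lambda>(t, r). S (t - t * r) (f (t * r)))"
    unfolding case_prod_beta'
    by (intro continuous_intros continuous_on_compose2[OF f]) (use dom in force)+
  then have "continuous_on {0..b} (\<lambda>t. t *\<^sub>R integral (cbox 0 1) (\<lambda>r. S (t - t * r) (f (t * r))))"
    by (intro continuous_intros integral_continuous_on_param)
  then show ?thesis
    by (rule continuous_on_eq) (simp add: eq)
qed

lemma conv_diff:
  assumes "continuous_on {0..t} f" "continuous_on {0..t} h"
  shows "conv (\<lambda>s. f s - h s) t = conv f t - conv h t"
proof -
  have "conv (\<lambda>s. f s - h s) t = integral {0..t} (\<lambda>s. S (t - s) (f s) - S (t - s) (h s))"
    unfolding conv_def by (intro integral_cong) (auto simp: S_diff)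
  then show ?thesis
    using integral_diff[OF S_shift_integrable[OF assms(1)] S_shift_integrable[OF assms(2)], of t t]
    by (simp add: conv_def)
qed

text \<open>An antiderivative of the norm bound \<open>Q * exp (\<gamma> * x)\<close>. Only its
  differences enter, so the constant of integration may be chosen separately in the two
  cases.\<close>

definition growth :: "real \<Rightarrow> real"
  where "growth x = (if \<gamma> \<noteq> 0 then Q * exp (\<gamma> * x) / \<gamma> else Q * x)"

lemma norm_integral_shift_le:
  assumes f: "continuous_on {a..b} f" and "a \<le> b" "b \<le> r"
    and M: "\<And>s. s \<in> {a..b} \<Longrightarrow> norm (f s) \<le> M"
  shows "norm (integral {a..b} (\<lambda>s. S (r - s) (f s))) \<le> M * (growth (r - a) - growth (r - b))"
proof -
  have deriv: "(growth has_real_derivative Q * exp (\<gamma> * x)) (at x)" for x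
  proof (cases "\<gamma> = 0")
    case True
    have "((\<lambda>x. Q * x) has_real_derivative Q) (at x)" by (auto intro!: derivative_eq_intros)
    then show ?thesis unfolding growth_def[abs_def] using True by simp
  next
    case False
    have "((\<lambda>x. Q * exp (\<gamma> * x) / \<gamma>) has_real_derivative Q * exp (\<gamma> * x)) (at x)"
      using False by (auto intro!: derivative_eq_intros)
    then show ?thesis unfolding growth_def[abs_def] using False by simp
  qed
  \<comment> \<open>The outer minus sign cancels the one from the inner derivative of
    \<open>r - s\<close>.\<close>
  have "((\<lambda>s. - growth (r - s)) has_real_derivative Q * exp (\<gamma> * (r - s))) (at s within {a..b})" for s
  proof -
    have "((\<lambda>s. r - s) has_real_derivative -1) (at s within {a..b})"
      by (auto intro!: derivative_eq_intros)
    then show ?thesis using DERIV_minus[OF DERIV_chain2[OF deriv]] by fastforce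
  qed
  then have "((\<lambda>s. Q * exp (\<gamma> * (r - s))) has_integral (- growth (r - b) - (- growth (r - a)))) {a..b}"
    using \<open>a \<le> b\<close> by (intro fundamental_theorem_of_calculus)
      (simp_all add: has_real_derivative_iff_has_vector_derivative)
  then have int: "((\<lambda>s. M * (Q * exp (\<gamma> * (r - s)))) has_integral M * (growth (r - a) - growth (r - b))) {a..b}"
    by (drule_tac has_integral_mult_right[where c = M]) simp
  have "norm (S (r - s) (f s)) \<le> M * (Q * exp (\<gamma> * (r - s)))" if "s \<in> {a..b}" for s
  proof -
    have "norm (S (r - s) (f s)) \<le> Q * exp (\<gamma> * (r - s)) * norm (f s)"
      using that \<open>b \<le> r\<close> by (intro norm_S_le) auto
    also have "\<dots> \<le> Q * exp (\<gamma> * (r - s)) * M"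
      using M[OF that] Q_nonneg by (intro mult_left_mono) auto
    finally show ?thesis by (simp add: mult.commute)
  qed
  then have "norm (integral {a..b} (\<lambda>s. S (r - s) (f s)))
      \<le> integral {a..b} (\<lambda>s. M * (Q * exp (\<gamma> * (r - s))))"
    using int S_shift_integrable[OF f \<open>b \<le> r\<close>]
    by (intro integral_norm_bound_integral) (auto simp: has_integral_iff)
  then show ?thesis unfolding integral_unique[OF int] .
qed

end

section \<open>Forcing terms and the sup norm over one period\<close>

lemma continuous_on_forcing:
  assumes "continuous_on ({0..} \<times> UNIV) (\<lambda>(t, y). g t y)"
    and "continuous_on A u" and "A \<subseteq> {0..}"
  shows "continuous_on A (\<lambda>s. g s (u s))"
proof -
  have "(\<lambda>s. (s, u s)) ` A \<subseteq> {0..} \<times> UNIV" using assms(3) by auto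
  then show ?thesis
    using continuous_on_compose2[OF assms(1) continuous_on_Pair[OF continuous_on_id assms(2)]] by simp
qed

lemma bdd_above_norm:
  fixes h :: "real \<Rightarrow> 'a::real_normed_vector"
  assumes "continuous_on {0..\<omega>} h"
  shows "bdd_above ((\<lambda>t. norm (h t)) ` {0..\<omega>})"
  using assms
  by (intro bounded_imp_bdd_above compact_imp_bounded compact_continuous_image continuous_intros) auto

lemma norm_le_norm0:
  "continuous_on {0..\<omega>} h \<Longrightarrow> t \<in> {0..\<omega>} \<Longrightarrow> norm (h t) \<le> norm0 \<omega> h"
  unfolding norm0_def by (intro cSUP_upper bdd_above_norm)

lemma norm0_le:
  "\<omega> > 0 \<Longrightarrow> (\<And>t. t \<in> {0..\<omega>} \<Longrightarrow> norm (h t) \<le> M) \<Longrightarrow> norm0 \<omega> h \<le> M"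
  unfolding norm0_def by (intro cSUP_least) auto

section \<open>The periodic problem for a given forcing\<close>

locale periodic_C0_semigroup = bounded_C0_semigroup +
  fixes \<omega> :: real and c :: complex
  assumes period_pos: "\<omega> > 0" and regular: "c \<notin> spectrum (S \<omega>)"
begin

definition R :: "'a \<Rightarrow> 'a"
  where "R = inv (\<lambda>x. c *\<^sub>C x - S \<omega> x)"

lemma R_bounded_linear: "bounded_linear R"
  using regular by (simp add: spectrum_def resolvent_set_def R_def bounded_clinear_def)

lemma R_plus: "R (x + y) = R x + R y"
  and R_diff: "R (x - y) = R x - R y"
  using R_bounded_linear by (simp_all add: linear_simps)

lemma R_left: "R (c *\<^sub>C x - S \<omega> x) = x"
  and R_right: "c *\<^sub>C R x - S \<omega> (R x) = x"
proof -
  have bij: "bij (\<lambda>x. c *\<^sub>C x - S \<omega> x)"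
    using regular by (simp add: spectrum_def resolvent_set_def)
  show "R (c *\<^sub>C x - S \<omega> x) = x" "c *\<^sub>C R x - S \<omega> (R x) = x"
    using inv_f_f[OF bij_is_inj[OF bij], of x] surj_f_inv_f[OF bij_is_surj[OF bij], of x]
    unfolding R_def by simp_all
qed

text \<open>\<open>S t\<close> commutes with \<open>S \<omega>\<close> and with complex scalars,
  hence with the operator that \<open>R\<close> inverts. Writing \<open>x\<close> as the image of
  \<open>R x\<close> under that operator transfers this to \<open>R\<close>.\<close>

lemma R_commute:
  assumes "t \<ge> 0"
  shows "S t (R x) = R (S t x)"
proof -
  have "S t x = S t (c *\<^sub>C R x - S \<omega> (R x))" by (simp add: R_right)
  also have "\<dots> = c *\<^sub>C S t (R x) - S (t + \<omega>) (R x)"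
    using assms period_pos by (simp add: S_diff S_scaleC S_add)
  also have "\<dots> = c *\<^sub>C S t (R x) - S \<omega> (S t (R x))"
    using assms period_pos by (simp add: S_add[symmetric] add.commute)
  finally show ?thesis by (simp add: R_left)
qed

text \<open>The value on \<open>[0,\<omega>]\<close> of the periodic mild solution with forcing \<open>f\<close>: the period
  condition \<open>S(\<omega>) y\<^sub>0 + conv f \<omega> = c y\<^sub>0\<close> determines \<open>y\<^sub>0\<close>.\<close>

definition sol :: "(real \<Rightarrow> 'a) \<Rightarrow> real \<Rightarrow> 'a"
  where "sol f t = S t (R (conv f \<omega>)) + conv f t"

lemma sol_0: "sol f 0 = R (conv f \<omega>)"
  by (simp add: sol_def S_0 conv_def)

lemma sol_period: "sol f \<omega> = c *\<^sub>C sol f 0"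
  using R_right[of "conv f \<omega>"] unfolding sol_0 by (simp add: sol_def algebra_simps)

lemma continuous_on_sol:
  "continuous_on {0..\<omega>} f \<Longrightarrow> continuous_on {0..\<omega>} (sol f)"
  unfolding sol_def[abs_def] by (intro continuous_intros continuous_on_conv) auto

lemma sol_diff:
  assumes "continuous_on {0..\<omega>} f" "continuous_on {0..\<omega>} h" "t \<in> {0..\<omega>}"
  shows "sol (\<lambda>s. f s - h s) t = sol f t - sol h t"
proof -
  have "conv (\<lambda>s. f s - h s) \<omega> = conv f \<omega> - conv h \<omega>"
    using assms by (intro conv_diff)
  moreover have "conv (\<lambda>s. f s - h s) t = conv f t - conv h t"
    using assms by (intro conv_diff) (auto elim: continuous_on_subset)
  ultimately show ?thesis
    using assms(3) by (simp add: sol_def R_diff S_diff)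
qed

lemma sol_cong:
  assumes "\<And>s. s \<in> {0..\<omega>} \<Longrightarrow> f s = h s" "t \<in> {0..\<omega>}"
  shows "sol f t = sol h t"
proof -
  have "conv f r = conv h r" if "r \<in> {0..\<omega>}" for r
    unfolding conv_def using that assms(1) by (intro integral_cong) auto
  then show ?thesis using assms(2) period_pos by (simp add: sol_def)
qed

text \<open>The difference of \<open>growth\<close> is the integral of the norm bound over one
  period, which covers zero and nonzero \<open>\<gamma>\<close> at once; \<open>gain\<close> is the
  constant \<open>U\<close> of the theorem.\<close>

definition gain :: real
  where "gain = (growth \<omega> - growth 0) * onorm R * max (cmod c) 1"

lemma gain_eq:
  "gain = (if \<gamma> \<noteq> 0
    then Q * (exp (\<gamma> * \<omega>) - 1) / \<gamma> * onorm (inv (\<lambda>x. c *\<^sub>C x - S \<omega> x)) * max (cmod c) 1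
    else Q * \<omega> * onorm (inv (\<lambda>x. c *\<^sub>C x - S \<omega> x)) * max (cmod c) 1)"
  unfolding gain_def growth_def R_def
  by (simp add: right_diff_distrib diff_divide_distrib)

text \<open>The estimate is made after \<open>R\<close> has been pulled in front of the whole
  expression, so that \<open>onorm R\<close> enters only once and the semigroup times of the two
  integrals do not overlap.\<close>

lemma norm_sol_le:
  assumes f: "continuous_on {0..\<omega>} f" and t: "t \<in> {0..\<omega>}"
    and M: "\<And>s. s \<in> {0..\<omega>} \<Longrightarrow> norm (f s) \<le> M"
  shows "norm (sol f t) \<le> gain * M"
proof -
  define m where "m = max (cmod c) 1"
  let ?J = "integral {t..\<omega>} (\<lambda>s. S (t + \<omega> - s) (f s))"
  have f_low: "continuous_on {0..t} f" and f_high: "continuous_on {t..\<omega>} f"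
    using t by (auto intro: continuous_on_subset[OF f])
  have "S t (conv f \<omega>) = integral {0..\<omega>} (\<lambda>s. S (t + \<omega> - s) (f s))"
    unfolding conv_def using f t by (intro S_integral_shift) auto
  \<comment> \<open>Splitting at \<open>t\<close> isolates the part of the forcing already seen by
    \<open>conv f t\<close>; its times are all at least \<open>\<omega>\<close>, so
    \<open>S \<omega>\<close> factors out.\<close>
  also have "\<dots> = integral {0..t} (\<lambda>s. S (\<omega> + t - s) (f s)) + ?J"
    using Henstock_Kurzweil_Integration.integral_combine[of 0 t \<omega> "\<lambda>s. S (t + \<omega> - s) (f s)"]
      S_shift_integrable[OF f, of "t + \<omega>"] t by (simp add: add.commute)
  also have "integral {0..t} (\<lambda>s. S (\<omega> + t - s) (f s)) = S \<omega> (conv f t)"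
    unfolding conv_def using f_low period_pos by (intro S_integral_shift[symmetric]) auto
  finally have "S t (R (conv f \<omega>)) = R (S \<omega> (conv f t)) + R ?J"
    using t by (simp add: R_commute R_plus)
  \<comment> \<open>By \<open>R_left\<close>, \<open>conv f t\<close> equals \<open>R\<close>
    applied to \<open>c *\<^sub>C conv f t - S \<omega> (conv f t)\<close>; the terms with
    \<open>S \<omega>\<close> cancel.\<close>
  then have sol: "sol f t = R (?J + c *\<^sub>C conv f t)"
    using R_left[of "conv f t"] by (simp add: sol_def R_plus R_diff diff_eq_eq)
  have "norm ?J \<le> M * (growth (t + \<omega> - t) - growth (t + \<omega> - \<omega>))"
    using t by (intro norm_integral_shift_le f_high M) auto
  then have J: "norm ?J \<le> M * (growth \<omega> - growth t)" by simp
  have "norm (conv f t) \<le> M * (growth (t - 0) - growth (t - t))"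
    unfolding conv_def using t by (intro norm_integral_shift_le f_low M) auto
  then have C: "norm (conv f t) \<le> M * (growth t - growth 0)" by simp
  have "norm (?J + c *\<^sub>C conv f t) \<le> norm ?J + cmod c * norm (conv f t)"
    by (metis norm_triangle_ineq norm_scaleC)
  \<comment> \<open>Replacing the weights 1 and \<open>cmod c\<close> by their common bound
    \<open>m\<close> lets the terms with \<open>growth t\<close> cancel, so the final bound does not
    depend on \<open>t\<close>.\<close>
  also have "\<dots> \<le> m * norm ?J + m * norm (conv f t)"
    using mult_right_mono[of 1 m "norm ?J"] mult_right_mono[of "cmod c" m "norm (conv f t)"]
    by (simp add: m_def)
  also have "\<dots> \<le> m * (M * (growth \<omega> - growth t)) + m * (M * (growth t - growth 0))"
    using J C by (intro add_mono mult_left_mono) (auto simp: m_def)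
  also have "\<dots> = (growth \<omega> - growth 0) * m * M" by (simp add: algebra_simps)
  finally have "norm (?J + c *\<^sub>C conv f t) \<le> (growth \<omega> - growth 0) * m * M" .
  then have "onorm R * norm (?J + c *\<^sub>C conv f t) \<le> onorm R * ((growth \<omega> - growth 0) * m * M)"
    by (intro mult_left_mono onorm_pos_le R_bounded_linear)
  then have "norm (sol f t) \<le> onorm R * ((growth \<omega> - growth 0) * m * M)"
    unfolding sol using onorm[OF R_bounded_linear] order_trans by blast
  then show ?thesis by (simp add: gain_def m_def mult_ac)
qed

text \<open>Zero forcing is bounded by 1, so \<open>norm_sol_le\<close> puts a norm below
  \<open>gain\<close>; no discussion of the sign of \<open>\<gamma>\<close> is needed.\<close>

lemma gain_nonneg: "gain \<ge> 0"
proof -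
  have "norm (sol (\<lambda>_. 0) 0) \<le> gain * 1"
    using period_pos by (intro norm_sol_le) auto
  with norm_ge_zero[of "sol (\<lambda>_. 0) 0"] show ?thesis by linarith
qed

section \<open>Periodic mild solutions as fixed points\<close>

text \<open>The mild formula at 0 identifies \<open>y0\<close> with \<open>z 0\<close>. Periodicity
  at time 0 alone then gives an equation for \<open>y0\<close> that \<open>R\<close> solves.\<close>

lemma mild_periodic_fixed:
  assumes g: "continuous_on ({0..} \<times> UNIV) (\<lambda>(t, y). g t y)"
    and z: "mild_solution S g z" "omega_c_periodic \<omega> c z" and t: "t \<in> {0..\<omega>}"
  shows "z t = sol (\<lambda>s. g s (z s)) t"
proof -
  obtain y0 where y0: "\<And>t. t \<ge> 0 \<Longrightarrow> z t = S t y0 + conv (\<lambda>s. g s (z s)) t"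
    using z(1) by (auto simp: mild_solution_def conv_def)
  have "z (0 + \<omega>) = c *\<^sub>C z 0"
    using z(2) unfolding omega_c_periodic_def by blast
  moreover have "z 0 = y0" using y0[of 0] by (simp add: conv_def S_0)
  ultimately have "c *\<^sub>C y0 = z \<omega>" by simp
  then have "c *\<^sub>C y0 - S \<omega> y0 = conv (\<lambda>s. g s (z s)) \<omega>"
    using y0[of \<omega>] period_pos by simp
  then have "R (conv (\<lambda>s. g s (z s)) \<omega>) = y0" using R_left by metis
  then show ?thesis using y0 t by (simp add: sol_def)
qed

text \<open>Splitting the convolution over \<open>[0, t + \<omega>]\<close> at \<open>\<omega>\<close> turns the periodicity of the
  forcing into that of the solution, so it suffices to solve on \<open>[0,\<omega>]\<close>.\<close>

lemma fixed_imp_mild: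
  assumes f: "continuous_on {0..} (\<lambda>s. g s (y s))"
    and f_per: "\<And>s. s \<ge> 0 \<Longrightarrow> g (s + \<omega>) (y (s + \<omega>)) = c *\<^sub>C g s (y s)"
    and y: "continuous_on {0..} y" "omega_c_periodic \<omega> c y"
    and fixed: "\<And>t. t \<in> {0..\<omega>} \<Longrightarrow> y t = sol (\<lambda>s. g s (y s)) t"
  shows "mild_solution S g y"
proof -
  define f where "f = (\<lambda>s. g s (y s))"
  have f_on: "continuous_on {a..b} f" if "a \<ge> 0" for a b
    unfolding f_def using that by (intro continuous_on_subset[OF f]) auto
  \<comment> \<open>This uses only the periodicity of the forcing \<open>f\<close>, not the fixed
    point equation.\<close>
  have shift: "sol f (t + \<omega>) = c *\<^sub>C sol f t" if t: "t \<ge> 0" for t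
  proof -
    have "conv f (t + \<omega>) = integral {0..\<omega>} (\<lambda>s. S (t + \<omega> - s) (f s))
        + integral {\<omega>..t + \<omega>} (\<lambda>s. S (t + \<omega> - s) (f s))"
      unfolding conv_def using t period_pos
      by (intro Henstock_Kurzweil_Integration.integral_combine[symmetric] S_shift_integrable f_on) auto
    also have "integral {0..\<omega>} (\<lambda>s. S (t + \<omega> - s) (f s)) = S t (conv f \<omega>)"
      unfolding conv_def using t by (intro S_integral_shift[symmetric] f_on) auto
    also have "integral {\<omega>..t + \<omega>} (\<lambda>s. S (t + \<omega> - s) (f s))
        = integral {0..t} (\<lambda>s. S (t + \<omega> - (s + \<omega>)) (f (s + \<omega>)))"
      using integral_shift_real_ivl[of \<omega> \<omega> "t + \<omega>" "\<lambda>s. S (t + \<omega> - s) (f s)"] by simp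
    also have "\<dots> = integral {0..t} (\<lambda>s. c *\<^sub>C S (t - s) (f s))"
      by (intro integral_cong) (auto simp: f_def f_per S_scaleC)
    also have "\<dots> = c *\<^sub>C conv f t"
      unfolding conv_def by (intro integral_scaleC S_shift_integrable f_on) auto
    finally have "sol f (t + \<omega>) = S t (S \<omega> (R (conv f \<omega>)) + conv f \<omega>) + c *\<^sub>C conv f t"
      using t period_pos by (simp add: sol_def S_add S_plus add.assoc)
    \<comment> \<open>This is the period condition on the initial value, read off from
      \<open>sol_period\<close>.\<close>
    also have "S \<omega> (R (conv f \<omega>)) + conv f \<omega> = c *\<^sub>C R (conv f \<omega>)"
      using sol_period[of f] by (simp add: sol_0) (simp add: sol_def)
    finally show ?thesis using t by (simp add: S_scaleC sol_def scaleC_add_right)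
  qed
  have "y t = sol f t" if "t \<ge> 0" for t
    using period_pos that
  proof (induction t rule: nonneg_period_induct)
    case (base t)
    then show ?case using fixed by (simp add: f_def)
  next
    case (step t)
    then show ?case using y(2) shift by (simp add: omega_c_periodic_def)
  qed
  moreover have "(\<lambda>s. S (t - s) (f s)) integrable_on {0..t}" for t
    by (intro S_shift_integrable f_on) auto
  ultimately show ?thesis
    using y(1) unfolding mild_solution_def f_def sol_def conv_def by blast
qed

text \<open>\<open>sol\<close> is linear in the forcing, so the difference is \<open>sol\<close> of
  a forcing bounded by \<open>L * d\<close>. The estimate serves both the contraction and the
  uniqueness argument.\<close>

lemma norm_sol_diff_le:
  assumes g: "continuous_on ({0..} \<times> UNIV) (\<lambda>(t, y). g t y)"
    and lip: "\<And>t y1 y2. t \<ge> 0 \<Longrightarrow> norm (g t y1 - g t y2) \<le> L * norm (y1 - y2)"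
    and "L \<ge> 0" and u: "continuous_on {0..\<omega>} u" and v: "continuous_on {0..\<omega>} v"
    and d: "\<And>s. s \<in> {0..\<omega>} \<Longrightarrow> norm (u s - v s) \<le> d" and t: "t \<in> {0..\<omega>}"
  shows "norm (sol (\<lambda>s. g s (u s)) t - sol (\<lambda>s. g s (v s)) t) \<le> L * gain * d"
proof -
  have cont: "continuous_on {0..\<omega>} (\<lambda>s. g s (u s))" "continuous_on {0..\<omega>} (\<lambda>s. g s (v s))"
    by (intro continuous_on_forcing[OF g] u v, simp)+
  have "norm (g s (u s) - g s (v s)) \<le> L * d" if "s \<in> {0..\<omega>}" for s
    using lip[of s "u s" "v s"] d[OF that] that \<open>L \<ge> 0\<close>
    by (auto intro: order_trans mult_left_mono)
  then have "norm (sol (\<lambda>s. g s (u s) - g s (v s)) t) \<le> gain * (L * d)"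
    using t by (intro norm_sol_le continuous_intros cont) auto
  then show ?thesis by (simp add: sol_diff[OF cont t] mult_ac)
qed

text \<open>Banach's theorem is applied in the complete space of bounded continuous functions on the
  whole line. The image of a function is computed on one period and continued by its endpoint values
  via \<open>clamp\<close>.\<close>

lemma fixed_point_exists:
  assumes g: "continuous_on ({0..} \<times> UNIV) (\<lambda>(t, y). g t y)"
    and lip: "\<And>t y1 y2. t \<ge> 0 \<Longrightarrow> norm (g t y1 - g t y2) \<le> L * norm (y1 - y2)"
    and "L \<ge> 0" and "L * gain < 1"
  obtains u where "continuous_on {0..\<omega>} u"
    and "\<And>t. t \<in> {0..\<omega>} \<Longrightarrow> u t = sol (\<lambda>s. g s (u s)) t"
proof -
  have "\<exists>w :: real \<Rightarrow>\<^sub>C 'a. (\<forall>t\<in>{0..\<omega>}. w t = sol (\<lambda>s. g s (u s)) t) \<and>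
      (\<forall>t. w t = sol (\<lambda>s. g s (u s)) (clamp 0 \<omega> t))" for u :: "real \<Rightarrow>\<^sub>C 'a"
  proof -
    have "continuous_on {0..\<omega>} (sol (\<lambda>s. g s (u s)))"
      by (intro continuous_on_sol continuous_on_forcing[OF g]) auto
    then obtain w :: "real \<Rightarrow>\<^sub>C 'a" where
      "\<And>t. t \<in> cbox 0 \<omega> \<Longrightarrow> w t = sol (\<lambda>s. g s (u s)) t"
      "\<And>t. w t = sol (\<lambda>s. g s (u s)) (clamp 0 \<omega> t)"
      unfolding cbox_interval[symmetric] by (rule continuous_on_cbox_bcontfunE) blast
    then show ?thesis by (intro exI[of _ w]) simp
  qed
  then obtain T :: "(real \<Rightarrow>\<^sub>C 'a) \<Rightarrow> (real \<Rightarrow>\<^sub>C 'a)"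
    where T: "\<And>u t. t \<in> {0..\<omega>} \<Longrightarrow> T u t = sol (\<lambda>s. g s (u s)) t"
      and T_clamp: "\<And>u t. T u t = sol (\<lambda>s. g s (u s)) (clamp 0 \<omega> t)"
    by metis
  have "dist (T u) (T v) \<le> L * gain * dist u v" for u v
  proof (rule dist_bound)
    fix t
    \<comment> \<open>Every value of \<open>T u\<close> is a value of \<open>sol\<close> on the
      period, so the estimate there bounds the distance over the whole line.\<close>
    have "clamp 0 \<omega> t \<in> {0..\<omega>}"
      using clamp_in_interval[of 0 \<omega> t] period_pos by simp
    then show "dist (T u t) (T v t) \<le> L * gain * dist u v"
      unfolding T_clamp dist_norm[of "sol _ _"]
      by (intro norm_sol_diff_le[OF g lip \<open>L \<ge> 0\<close>])
        (auto simp: dist_norm[symmetric] dist_bounded)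
  qed
  then have "\<exists>!u. T u = u"
    using \<open>L \<ge> 0\<close> \<open>L * gain < 1\<close> gain_nonneg by (intro banach_fix_type) auto
  then obtain u where "T u = u" by blast
  then show thesis using that[of "apply_bcontfun u"] T[of _ u] by auto
qed

end

theorem theorem5p2:
  fixes S :: "real \<Rightarrow> 'a::complex_banach \<Rightarrow> 'a"
    and D :: "'a set" and A :: "'a \<Rightarrow> 'a"
    and g :: "real \<Rightarrow> 'a \<Rightarrow> 'a"
    and \<omega> Q \<gamma> L U :: real and c :: complex
  assumes "\<omega> > 0" and "c \<noteq> 0"
    and "C0_semigroup S" and "infinitesimal_generator S D A"
    and "Q \<ge> 1" and "\<And>t. t \<ge> 0 \<Longrightarrow> onorm (S t) \<le> Q * exp (\<gamma> * t)"
    and "c \<notin> spectrum (S \<omega>)"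
    and "continuous_on ({0..} \<times> UNIV) (\<lambda>(t, y). g t y)"
    and "\<And>t y. t \<ge> 0 \<Longrightarrow> g (t + \<omega>) (c *\<^sub>C y) = c *\<^sub>C g t y"
    and "L > 0"
    and "\<And>t y1 y2. t \<ge> 0 \<Longrightarrow> norm (g t y1 - g t y2) \<le> L * norm (y1 - y2)"
    and "U = (if \<gamma> \<noteq> 0
      then Q * (exp (\<gamma> * \<omega>) - 1) / \<gamma> * onorm (inv (\<lambda>x. c *\<^sub>C x - S \<omega> x)) * max (cmod c) 1
      else Q * \<omega> * onorm (inv (\<lambda>x. c *\<^sub>C x - S \<omega> x)) * max (cmod c) 1)"
    and "L * U < 1"
  shows "\<exists>y. mild_solution S g y \<and> omega_c_periodic \<omega> c y \<and>
    (\<forall>z. mild_solution S g z \<and> omega_c_periodic \<omega> c z \<longrightarrow> (\<forall>t\<ge>0. z t = y t)) \<and>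
    norm0 \<omega> y \<le> U * norm0 \<omega> (\<lambda>t. g t 0) / (1 - L * U)"
proof -
  interpret periodic_C0_semigroup S Q \<gamma> \<omega> c
    using assms(1,3,6,7) by unfold_locales
  note g = assms(8) and g_per = assms(9) and lip = assms(11)
  have U: "U = gain" unfolding gain_eq by (rule assms(12))
  have "L \<ge> 0" using \<open>L > 0\<close> by simp
  have "L * gain < 1" using \<open>L * U < 1\<close> U by simp
  obtain u where u: "continuous_on {0..\<omega>} u"
    "\<And>t. t \<in> {0..\<omega>} \<Longrightarrow> u t = sol (\<lambda>s. g s (u s)) t"
    using fixed_point_exists[OF g lip \<open>L \<ge> 0\<close> \<open>L * gain < 1\<close>] by blast
  have "u \<omega> = c *\<^sub>C u 0" using u(2) sol_period period_pos by simp
  then obtain y where y_cont: "continuous_on {0..} y" and y_per: "omega_c_periodic \<omega> c y"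
    and yu: "\<And>t. 0 \<le> t \<Longrightarrow> t \<le> \<omega> \<Longrightarrow> y t = u t"
    using omega_c_periodic_extension[OF period_pos u(1)] by blast
  have y_cont': "continuous_on {0..\<omega>} y" using y_cont by (rule continuous_on_subset) auto
  have y_fixed: "y t = sol (\<lambda>s. g s (y s)) t" if "t \<in> {0..\<omega>}" for t
  proof -
    have "y t = sol (\<lambda>s. g s (u s)) t" using u(2) yu that by simp
    \<comment> \<open>On one period \<open>sol\<close> sees the forcing only there, where
      \<open>u\<close> and its extension \<open>y\<close> agree.\<close>
    also have "\<dots> = sol (\<lambda>s. g s (y s)) t" using that by (intro sol_cong) (simp_all add: yu)
    finally show ?thesis .
  qed
  have mild: "mild_solution S g y"
    using y_per g_per y_cont y_fixed
    by (intro fixed_imp_mild continuous_on_forcing[OF g]) (auto simp: omega_c_periodic_def)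
  have unique: "z t = y t"
    if z: "mild_solution S g z" "omega_c_periodic \<omega> c z" and "t \<ge> 0" for z t
    using period_pos \<open>t \<ge> 0\<close>
  proof (induction t rule: nonneg_period_induct)
    case (base t)
    \<comment> \<open>Both functions satisfy the fixed point equation on the first period, so their
      sup distance satisfies \<open>d \<le> L * gain * d\<close>, which rules out
      \<open>d > 0\<close>.\<close>
    define d where "d = norm0 \<omega> (\<lambda>t. z t - y t)"
    have z_cont: "continuous_on {0..\<omega>} z"
      using z(1) by (auto simp: mild_solution_def elim: continuous_on_subset)
    have d: "norm (z t - y t) \<le> d" if "t \<in> {0..\<omega>}" for t
      unfolding d_def using that
      by (intro norm_le_norm0[of \<omega> "\<lambda>t. z t - y t"] continuous_intros z_cont y_cont')
    have "norm0 \<omega> (\<lambda>t. z t - y t) \<le> L * gain * d"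
    proof (rule norm0_le[OF period_pos])
      fix t assume t: "t \<in> {0..\<omega>}"
      show "norm (z t - y t) \<le> L * gain * d"
        using norm_sol_diff_le[OF g lip \<open>L \<ge> 0\<close> z_cont y_cont' d t]
        by (simp only: mild_periodic_fixed[OF g z t, symmetric] y_fixed[OF t, symmetric])
    qed
    then have "d \<le> L * gain * d" by (simp add: d_def)
    then have "(1 - L * gain) * d \<le> 0" by (simp add: algebra_simps)
    then have "d \<le> 0" using \<open>L * gain < 1\<close> by (simp add: mult_le_0_iff)
    moreover have "norm (z t - y t) \<le> d" using base by (intro d) simp
    ultimately have "norm (z t - y t) \<le> 0" by linarith
    then show ?case by simp
  next
    case (step t)
    then show ?case using z(2) y_per by (simp add: omega_c_periodic_def)
  qed
  define G where "G = norm0 \<omega> (\<lambda>t. g t 0)"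
  have g0: "norm (g t 0) \<le> G" if "t \<in> {0..\<omega>}" for t
    unfolding G_def using that
    by (intro norm_le_norm0[of \<omega> "\<lambda>t. g t 0"] continuous_on_forcing[OF g]) auto
  \<comment> \<open>Comparing \<open>g s (y s)\<close> with \<open>g s 0\<close> bounds the forcing
    in terms of \<open>y\<close> itself. As \<open>L * U < 1\<close>, the resulting inequality can
    be solved for the norm of \<open>y\<close>.\<close>
  have "norm0 \<omega> y \<le> gain * (L * norm0 \<omega> y + G)"
  proof (rule norm0_le[OF period_pos])
    fix t assume t: "t \<in> {0..\<omega>}"
    have "norm (g s (y s)) \<le> L * norm0 \<omega> y + G" if s: "s \<in> {0..\<omega>}" for s
    proof -
      have "norm (g s (y s)) \<le> norm (g s (y s) - g s 0) + norm (g s 0)"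
        by (metis diff_add_cancel norm_triangle_ineq)
      also have "\<dots> \<le> L * norm (y s) + G"
        using lip[of s "y s" 0] g0[OF s] s by auto
      also have "\<dots> \<le> L * norm0 \<omega> y + G"
        using norm_le_norm0[OF y_cont' s] \<open>L \<ge> 0\<close> by (simp add: mult_left_mono)
      finally show ?thesis .
    qed
    then show "norm (y t) \<le> gain * (L * norm0 \<omega> y + G)"
      unfolding y_fixed[OF t] using t
      by (intro norm_sol_le continuous_on_forcing[OF g] y_cont') auto
  qed
  then have "norm0 \<omega> y \<le> U * G / (1 - L * U)"
    using \<open>L * U < 1\<close> by (simp add: U field_simps)
  then show ?thesis using mild y_per unique unfolding G_def by blast
qed

end
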